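(* Let $\mu$ be an ergodic $\sigma$-invariant Borel probability measure on $\Omega=\{-1,0,+1\}^{\mathbb Z}$ which is strongly asymmetric. Let $x,y\in X=\{0,1\}^{\mathbb Z}$ be two periodic sceneries that are not translates of each other (i.e. there is no $k\in\mathbb Z$ with $y=T^kx$). Let $\lambda$ and $\lambda'$ be the scenery measures generated by $x$ and $y$, respectively, and suppose that the global record measures $\rho=(\mu\times\lambda)\circ\Phi^{-1}$ and $\rho'=(\mu\times\lambda')\circ\Phi^{-1}$ are ergodic with respect to $T$. Then $x$ and $y$ are distinguishable, that is, the record measures $\rho_x$ and $\rho_y$ are mutually singular: $\rho_x\perp\rho_y$.
   Context: Let $J=\{-1,0,+1\}$ be the set of steps, whose elements are also written $\mathtt L=-1$, $\mathtt H=0$, $\mathtt R=+1$ (left, hold, right). Let $\Omega=J^{\mathbb Z}$ with its Borel $\sigma$-algebra and left shift $\sigma$, $(\sigma\omega)_n=\omega_{n+1}$. A generalized random walk with holding is given by an ergodic shift-invariant probability measure $\mu$ on $\Omega$ (holding steps are allowed but $\mu(\omega_0=0)=0$ is not excluded). For a word $u=u_1\dots u_n$ over $J$ put $\mu[u]=\mu(\{\omega\in\Omega:\omega_0\dots\omega_{n-1}=u\})$. Write $\mathtt R^N$ and $\mathtt L^N$ for the words consisting of $N$ letters $\mathtt R$, respectively $N$ letters $\mathtt L$. The walk (or $\mu$) is called strongly asymmetric if $\mu[\mathtt R^N]\neq\mu[\mathtt L^N]$ for every integer $N\ge 1$. Let $X=\{0,1\}^{\mathbb Z}$ with its Borel $\sigma$-algebra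 and left shift $T$, $(Tx)_k=x_{k+1}$. Elements of $X$ are called sceneries. A scenery $x$ is periodic if $T^px=x$ for some integer $p\ge1$; the smallest such $p$ is $\mathrm{Per}(x)$. The scenery measure generated by a periodic scenery $x$ is $\frac{1}{\mathrm{Per}(x)}\sum_{k=0}^{\mathrm{Per}(x)-1}\delta_{T^kx}$, where $\delta_z$ denotes the point mass at $z$. For $\omega\in\Omega$ and $x\in X$ define $r_0(\omega,x)=x_0$; for $n\ge1$, $r_n(\omega,x)=(T^{\omega_0+\cdots+\omega_{n-1}}x)_0$; for $n<0$, $r_n(\omega,x)=(T^{-\omega_{-1}-\omega_{-2}-\cdots-\omega_{n}}x)_0$. The global recording map is $\Phi:\Omega\times X\to X$, $\Phi(\omega,x)=(r_n(\omega,x))_{n\in\mathbb Z}$. For fixed $x\in X$ the colour record map is $\varphi_x:\Omega\to X$, $\varphi_x(\omega)=\Phi(\omega,x)$, and the record measure of $x$ is $\rho_x=\mu\circ\varphi_x^{-1}$. The global record measure of a $T$-invariant probability measure $\lambda$ on $X$ is $\rho=(\mu\times\lambda)\circ\Phi^{-1}$; it is $T$-invariant. *)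

theory Defs
  imports "HOL-Probability.Probability"
begin

text \<open>
  The set \<open>{0, 1}\<close> of colours is \<^typ>\<open>bool\<close>, so that sceneries form the type
  \<^typ>\<open>int \<Rightarrow> bool\<close>. Both \<^typ>\<open>bool\<close> and \<^typ>\<open>int\<close> carry the discrete topology and
  function types the product topology; \<^term>\<open>borel :: (int \<Rightarrow> bool) measure\<close> is therefore
  the Borel sigma-algebra of \<open>{0, 1}\<^sup>\<int>\<close>, and \<open>step_space\<close> below is that of
  \<open>{-1, 0, 1}\<^sup>\<int>\<close> (the measure that \<^const>\<open>borel\<close> and \<^const>\<open>restrict_space\<close> put on
  their sets is irrelevant).
\<close>

type_synonym scenery = "int \<Rightarrow> bool"

definition Omega :: "(int \<Rightarrow> int) set" where
  "Omega = {\<omega>. \<forall>n. \<omega> n \<in> {-1, 0, 1}}"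

definition step_space :: "(int \<Rightarrow> int) measure" where
  "step_space = restrict_space borel Omega"

definition left_shift :: "(int \<Rightarrow> 'a) \<Rightarrow> int \<Rightarrow> 'a" where
  "left_shift x = (\<lambda>n. x (n + 1))"

text \<open>The integer power of the shift; see the two lemmas that follow.\<close>

definition shift_pow :: "int \<Rightarrow> (int \<Rightarrow> 'a) \<Rightarrow> int \<Rightarrow> 'a" where
  "shift_pow k x = (\<lambda>n. x (n + k))"

lemma shift_pow_of_nat: "shift_pow (int k) = left_shift ^^ k"
  by (induction k) (auto simp: shift_pow_def left_shift_def fun_eq_iff ac_simps)

lemma shift_pow_uminus: "shift_pow (- k) = inv (shift_pow k)"
  by (rule sym, rule inv_unique_comp) (auto simp: shift_pow_def fun_eq_iff)

definition ergodic_measure :: "('a \<Rightarrow> 'a) \<Rightarrow> 'a measure \<Rightarrow> bool" where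
  "ergodic_measure T M \<longleftrightarrow>
     prob_space M \<and> T \<in> measurable M M \<and> distr M M T = M \<and>
     (\<forall>A\<in>sets M. T -` A \<inter> space M = A \<longrightarrow> measure M A = 0 \<or> measure M A = 1)"

definition mutually_singular :: "'a measure \<Rightarrow> 'a measure \<Rightarrow> bool" where
  "mutually_singular M N \<longleftrightarrow>
     sets M = sets N \<and> (\<exists>A\<in>sets M. emeasure M A = 0 \<and> emeasure N (space N - A) = 0)"

definition word_measure :: "(int \<Rightarrow> int) measure \<Rightarrow> int list \<Rightarrow> real" where
  "word_measure \<mu> u = measure \<mu> {\<omega>\<in>Omega. \<forall>i<length u. \<omega> (int i) = u ! i}"

definition strongly_asymmetric :: "(int \<Rightarrow> int) measure \<Rightarrow> bool" where
  "strongly_asymmetric \<mu> \<longleftrightarrow>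
     (\<forall>N\<ge>1. word_measure \<mu> (replicate N 1) \<noteq> word_measure \<mu> (replicate N (- 1)))"

definition periodic :: "scenery \<Rightarrow> bool" where
  "periodic x \<longleftrightarrow> (\<exists>p\<ge>1. (left_shift ^^ p) x = x)"

definition Per :: "scenery \<Rightarrow> nat" where
  "Per x = (LEAST p. p \<ge> 1 \<and> (left_shift ^^ p) x = x)"

definition scenery_measure :: "scenery \<Rightarrow> scenery measure" where
  "scenery_measure x = measure_of UNIV (sets borel)
     (\<lambda>A. 1 / of_nat (Per x) * (\<Sum>k<Per x. emeasure (return borel ((left_shift ^^ k) x)) A))"

text \<open>\<open>position \<omega> n\<close> is the displacement of the walk between times \<open>0\<close> and \<open>n\<close>.\<close>

definition position :: "(int \<Rightarrow> int) \<Rightarrow> int \<Rightarrow> int" where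
  "position \<omega> n = (if n \<ge> 0 then \<Sum>i\<in>{0..<n}. \<omega> i else - (\<Sum>i\<in>{n..-1}. \<omega> i))"

definition recording :: "(int \<Rightarrow> int) \<times> scenery \<Rightarrow> scenery" where
  "recording = (\<lambda>(\<omega>, x). \<lambda>n. shift_pow (position \<omega> n) x 0)"

definition colour_record :: "scenery \<Rightarrow> (int \<Rightarrow> int) \<Rightarrow> scenery" where
  "colour_record x \<omega> = recording (\<omega>, x)"

definition record_measure :: "(int \<Rightarrow> int) measure \<Rightarrow> scenery \<Rightarrow> scenery measure" where
  "record_measure \<mu> x = distr \<mu> borel (colour_record x)"

definition global_record_measure ::
  "(int \<Rightarrow> int) measure \<Rightarrow> scenery measure \<Rightarrow> scenery measure" where
  "global_record_measure \<mu> \<nu> = distr (\<mu> \<Otimes>\<^sub>M \<nu>) borel recording"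

text \<open>
  \<^const>\<open>measure_of\<close> and \<^const>\<open>distr\<close> yield the intended measures only for a countably
  additive set function and for a measurable map; the following facts establish this.
\<close>

lemma space_step_space: "space step_space = Omega"
  by (simp add: step_space_def space_restrict_space)

lemma sets_scenery_measure [simp, measurable_cong]: "sets (scenery_measure x) = sets borel"
  unfolding scenery_measure_def by (metis sets.sets_measure_of_eq space_borel)

lemma emeasure_scenery_measure:
  assumes "A \<in> sets borel"
  shows "emeasure (scenery_measure x) A =
    1 / of_nat (Per x) * (\<Sum>k<Per x. emeasure (return borel ((left_shift ^^ k) x)) A)"
proof (rule emeasure_measure_of[OF scenery_measure_def])
  show "countably_additive (sets (scenery_measure x))
    (\<lambda>A. 1 / of_nat (Per x) * (\<Sum>k<Per x. emeasure (return borel ((left_shift ^^ k) x)) A))"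
    unfolding countably_additive_def
  proof (intro allI impI)
    fix B :: "nat \<Rightarrow> scenery set"
    assume B: "range B \<subseteq> sets (scenery_measure x)" "disjoint_family B"
    have "(\<Sum>i. emeasure (return borel z) (B i)) = emeasure (return borel z) (\<Union>i. B i)"
      for z :: scenery
      using B by (intro suminf_emeasure) auto
    then show "(\<Sum>i. 1 / of_nat (Per x) *
        (\<Sum>k<Per x. emeasure (return borel ((left_shift ^^ k) x)) (B i))) =
      1 / of_nat (Per x) * (\<Sum>k<Per x. emeasure (return borel ((left_shift ^^ k) x)) (\<Union> (range B)))"
      by (simp add: suminf_sum)
  qed
qed (use assms in \<open>auto simp: positive_def\<close>)

lemma measurable_eval [measurable]:
  "(\<lambda>x :: int \<Rightarrow> 'a::topological_space. x n) \<in> borel_measurable borel"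
  by (intro borel_measurable_continuous_onI continuous_on_product_coordinates)

lemma measurable_borel_eq_count_space:
  "measurable M (borel :: 'a::{countable, t2_space} measure) = measurable M (count_space UNIV)"
  by (rule measurable_cong_sets[OF refl sets_borel_eq_count_space])

lemma measurable_position [measurable]:
  "(\<lambda>\<omega>. position \<omega> n) \<in> measurable step_space (count_space UNIV)"
proof -
  have eval: "(\<lambda>\<omega>. \<omega> i) \<in> measurable (borel :: (int \<Rightarrow> int) measure) (count_space UNIV)" for i
    using measurable_eval[where 'a = int, of i] unfolding measurable_borel_eq_count_space .
  have sum: "(\<lambda>\<omega>. \<Sum>i\<in>I. \<omega> i) \<in> measurable (borel :: (int \<Rightarrow> int) measure) (count_space UNIV)"
    if "finite I" for I
    using that
  proof (induction I rule: finite_induct)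
    case (insert j I)
    have "(\<lambda>\<omega>. (\<lambda>a \<omega>. a + (\<Sum>i\<in>I. \<omega> i)) (\<omega> j) \<omega>)
        \<in> measurable (borel :: (int \<Rightarrow> int) measure) (count_space UNIV)"
      by (rule measurable_compose_countable[OF measurable_compose[OF insert.IH] eval]) simp
    then show ?case
      using insert.hyps by simp
  qed simp
  have "(\<lambda>\<omega>. position \<omega> n) \<in> measurable (borel :: (int \<Rightarrow> int) measure) (count_space UNIV)"
  proof (cases "n \<ge> 0")
    case True
    then show ?thesis
      using sum[of "{0..<n}"] by (simp only: position_def if_True) simp
  next
    case False
    have "(\<lambda>\<omega>. - (\<Sum>i\<in>{n..-1}. \<omega> i)) \<in> measurable (borel :: (int \<Rightarrow> int) measure) (count_space UNIV)"
      by (rule measurable_compose[OF sum]) simp_all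
    with False show ?thesis
      by (simp only: position_def if_False)
  qed
  then show ?thesis
    unfolding step_space_def by (rule measurable_restrict_space1)
qed

instance bool :: second_countable_topology
proof
  have "countable (Pow (UNIV :: bool set))"
    by (intro countable_finite) simp
  moreover have "open S = generate_topology (Pow UNIV) S" for S :: "bool set"
    by (simp add: Topological_Spaces.open_discrete generate_topology.Basis)
  ultimately show "\<exists>B :: bool set set. countable B \<and> open = generate_topology B"
    by blast
qed

lemma measurable_into_scenery:
  assumes "\<And>n. (\<lambda>w. f w n) \<in> measurable M (count_space UNIV)"
  shows "f \<in> measurable M (borel :: scenery measure)"
proof -
  have "f \<in> measurable M (Pi\<^sub>M UNIV (\<lambda>_. borel))"
  proof (rule measurable_PiM_single')
    show "(\<lambda>w. f w n) \<in> borel_measurable M" for n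
      unfolding measurable_borel_eq_count_space by (rule assms)
  qed simp
  then show ?thesis
    unfolding measurable_cong_sets[OF refl sets_PiM_equal_borel] .
qed

lemma measurable_recording: "recording \<in> measurable (step_space \<Otimes>\<^sub>M borel) borel"
proof (rule measurable_into_scenery)
  fix n :: int
  have eval: "(\<lambda>x :: scenery. x k) \<in> measurable borel (count_space UNIV)" for k :: int
    using measurable_eval[where 'a = bool, of k] unfolding measurable_borel_eq_count_space .
  have "(\<lambda>w. (\<lambda>k w. (snd w :: scenery) k) (position (fst w) n) w)
      \<in> measurable (step_space \<Otimes>\<^sub>M borel) (count_space UNIV)"
    by (rule measurable_compose_countable
          [OF measurable_compose[OF measurable_snd eval]
              measurable_compose[OF measurable_fst measurable_position]])
  then show "(\<lambda>w. recording w n) \<in> measurable (step_space \<Otimes>\<^sub>M borel) (count_space UNIV)"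
    unfolding recording_def shift_pow_def case_prod_beta add_0_left .
qed

lemma measurable_colour_record: "colour_record x \<in> measurable step_space borel"
proof -
  have "(\<lambda>\<omega>. recording (\<omega>, x)) \<in> measurable step_space borel"
    by (rule measurable_compose[OF measurable_Pair2' measurable_recording]) simp
  then show ?thesis
    unfolding colour_record_def[abs_def] .
qed

end

theory Submission
  imports Defs
begin

text \<open>
  Two ergodic measures of the same transformation are equal or mutually singular
  (\<open>distinct_ergodic_measures_singular\<close>). Since the scenery measure of \<open>x\<close> charges the point \<open>x\<close>,
  every null set of the global record measure of \<open>x\<close> is a null set of the record measure of \<open>x\<close>
  (\<open>null_record_measure\<close>). Hence it suffices to show that the global record measures \<open>\<rho>\<close> and
  \<open>\<rho>'\<close> of \<open>x\<close> and \<open>y\<close> differ.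

  Suppose they coincide. By induction on \<open>n\<close>, the scenery measures \<open>\<lambda>\<close> and \<open>\<lambda>'\<close> then give the same
  distribution to the colours in a window of \<open>n\<close> consecutive sites
  (\<open>window_law_determined_by_record\<close>). For the step let \<open>w\<close> be a word of \<open>n + 1\<close> colours and let
  \<open>D(w)\<close> be the difference between the probabilities that \<open>\<lambda>\<close> and \<open>\<lambda>'\<close> give to \<open>w\<close>. The record
  begins with \<open>w\<close> when the first \<open>n\<close> steps follow some path and the scenery shows \<open>w\<close> along this path.
  A path of \<open>n\<close> steps that does not go straight in one direction visits at most \<open>n\<close> consecutive sites
  (\<open>straight_or_confined\<close>), so by the induction hypothesis and stationarity its contributions to
  \<open>\<rho>\<close> and \<open>\<rho>'\<close> are equal. What remains of \<open>\<rho>[w] = \<rho>'[w]\<close> comes from the two straight paths: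
  \<open>\<mu>[R\<^sup>n] D(w) + \<mu>[L\<^sup>n] D(rev w) = 0\<close>. The same equation for \<open>rev w\<close> completes a linear system in
  \<open>D(w)\<close> and \<open>D(rev w)\<close> with determinant \<open>\<mu>[R\<^sup>n]\<^sup>2 - \<mu>[L\<^sup>n]\<^sup>2\<close>, which strong asymmetry keeps away
  from \<open>0\<close>; therefore \<open>D(w) = 0\<close>.

  Finally, if all window distributions of \<open>x\<close> and \<open>y\<close> coincide, then a translate of \<open>x\<close> agrees with
  \<open>y\<close> on a common period, hence everywhere (\<open>translate_if_window_laws_eq\<close>), which is excluded.
\<close>

section \<open>Distinct ergodic measures are mutually singular\<close>

text \<open>
  By the Hahn decomposition, \<open>d = M - N\<close> attains its maximum over
  measurable sets. The maximisers of \<open>d\<close> are closed under preimages by \<open>T\<close>, under unions and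
  intersections and under monotone limits, so that the upper limit of the iterated preimages of one
  maximiser is a maximiser that is strictly invariant. By ergodicity its \<open>M\<close>- and \<open>N\<close>-measures are
  \<open>0\<close> or \<open>1\<close>, and the maximum of \<open>d\<close> is positive, so they are \<open>1\<close> and \<open>0\<close>.
\<close>

lemma distinct_ergodic_measures_singular:
  assumes M: "ergodic_measure T M" and N: "ergodic_measure T N"
    and sets_eq: "sets M = sets N" and "M \<noteq> N"
  shows "mutually_singular M N"
proof -
  interpret M: prob_space M using M by (simp add: ergodic_measure_def)
  interpret N: prob_space N using N by (simp add: ergodic_measure_def)
  have TM [measurable]: "T \<in> measurable M M" and invM: "distr M M T = M"
    using M by (auto simp: ergodic_measure_def)
  have TN [measurable]: "T \<in> measurable N N" and invN: "distr N N T = N"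
    using N by (auto simp: ergodic_measure_def)
  have space_eq: "space M = space N"
    using sets_eq by (rule sets_eq_imp_space_eq)
  define d where "d A = M.prob A - N.prob A" for A
  define pre where "pre A = T -` A \<inter> space M" for A
  obtain P where P: "P \<in> sets M" and P_pos: "\<And>X. X \<in> sets M \<Longrightarrow> X \<subseteq> P \<Longrightarrow> emeasure N X \<le> emeasure M X"
    and P_neg: "\<And>X. X \<in> sets M \<Longrightarrow> X \<subseteq> space M \<Longrightarrow> X \<inter> P = {} \<Longrightarrow> emeasure M X \<le> emeasure N X"
    using unsigned_Hahn_decomposition[of N M "space M"] sets_eq
    by (metis M.emeasure_finite N.emeasure_finite sets.top)
  define maxi where "maxi A \<longleftrightarrow> A \<in> sets M \<and> (\<forall>B\<in>sets M. d B \<le> d A)" for A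
  have d_diff: "d A = d (A \<inter> B) + d (A - B)" if "A \<in> sets M" "B \<in> sets M" for A B
    using that by (simp add: d_def M.finite_measure_Diff' N.finite_measure_Diff' sets_eq)
  have "maxi P"
  proof -
    have "d B \<le> d P" if B: "B \<in> sets M" for B
    proof -
      have "d (B - P) \<le> 0"
        using P_neg[of "B - P"] B P sets.sets_into_space[OF B]
        by (auto simp: d_def M.emeasure_eq_measure N.emeasure_eq_measure)
      moreover have "0 \<le> d (P - B)"
        using P_pos[of "P - B"] B P
        by (auto simp: d_def M.emeasure_eq_measure N.emeasure_eq_measure)
      ultimately show ?thesis
        using d_diff[OF B P] d_diff[OF P B] by (simp add: Int_commute)
    qed
    then show ?thesis using P by (simp add: maxi_def)
  qed
  have maxi_pre: "maxi (pre A)" if "maxi A" for A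
  proof -
    have A: "A \<in> sets M" using that by (simp add: maxi_def)
    have "M.prob (pre A) = M.prob A"
      using measure_distr[OF TM A] unfolding invM pre_def by (rule sym)
    moreover have "N.prob (pre A) = N.prob A"
      using measure_distr[OF TN A[unfolded sets_eq]] unfolding invN pre_def space_eq by (rule sym)
    ultimately have "d (pre A) = d A" by (simp add: d_def)
    moreover have "pre A \<in> sets M" using A by (simp add: pre_def)
    ultimately show ?thesis using that by (simp add: maxi_def)
  qed
  \<comment> \<open>\<open>d\<close> is modular, \<open>d (A \<union> B) + d (A \<inter> B) = d A + d B\<close>, and no summand on the left exceeds the maximum.\<close>
  have maxi_Un: "maxi (A \<union> B)" and maxi_Int: "maxi (A \<inter> B)" if "maxi A" "maxi B" for A B
  proof -
    have sets: "A \<in> sets M" "B \<in> sets M" using that by (auto simp: maxi_def)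
    have "(A \<union> B) \<inter> A = A" "(A \<union> B) - A = B - A" by auto
    then have *: "d (A \<union> B) + d (A \<inter> B) = d A + d B"
      using d_diff[of "A \<union> B" A] d_diff[of B A] sets by (simp add: Int_commute)
    have "d (A \<union> B) \<le> d A" "d (A \<inter> B) \<le> d B" "d A \<le> d B" "d B \<le> d A"
      using that sets by (simp_all add: maxi_def)
    with * have "d (A \<union> B) = d A" "d (A \<inter> B) = d A" by linarith+
    then show "maxi (A \<union> B)" "maxi (A \<inter> B)"
      using that sets by (auto simp: maxi_def)
  qed
  have maxi_lim: "maxi B" if "\<And>n. maxi (A n)" "B \<in> sets M" "(\<lambda>n. d (A n)) \<longlonglongrightarrow> d B"
    for A :: "nat \<Rightarrow> _" and B
    using that LIMSEQ_le_const[OF that(3)] by (auto simp: maxi_def)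
  have maxi_UN: "maxi (\<Union>n. A n)" if A: "\<And>n. maxi (A n)" "incseq A" for A :: "nat \<Rightarrow> _"
  proof (rule maxi_lim[OF A(1)])
    have "A n \<in> sets M" for n using A by (simp add: maxi_def)
    then show "(\<Union>n. A n) \<in> sets M" "(\<lambda>n. d (A n)) \<longlonglongrightarrow> d (\<Union>n. A n)"
      using A(2) sets_eq unfolding d_def
      by (auto intro!: tendsto_diff M.finite_Lim_measure_incseq N.finite_Lim_measure_incseq)
  qed
  have maxi_INT: "maxi (\<Inter>n. A n)" if A: "\<And>n. maxi (A n)" "decseq A" for A :: "nat \<Rightarrow> _"
  proof (rule maxi_lim[OF A(1)])
    have "A n \<in> sets M" for n using A by (simp add: maxi_def)
    then show "(\<Inter>n. A n) \<in> sets M" "(\<lambda>n. d (A n)) \<longlonglongrightarrow> d (\<Inter>n. A n)"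
      using A(2) sets_eq unfolding d_def
      by (auto intro!: tendsto_diff M.finite_Lim_measure_decseq N.finite_Lim_measure_decseq)
  qed
  have maxi_iter: "maxi ((pre ^^ n) A)" if "maxi A" for n A
    using that by (induction n) (auto intro: maxi_pre)
  \<comment> \<open>The upper limit is taken in two monotone limits: the union \<open>U\<close> satisfies only \<open>pre U \<subseteq> U\<close>,
    and the intersection of its iterated preimages is strictly invariant.\<close>
  define U where "U = (\<Union>n. \<Union>k\<le>n. (pre ^^ k) P)"
  have "maxi (\<Union>k\<le>n. (pre ^^ k) P)" for n
    by (induction n) (auto simp: atMost_Suc intro!: maxi_Un maxi_pre maxi_iter \<open>maxi P\<close>)
  then have "maxi U"
    unfolding U_def by (intro maxi_UN) (auto simp: incseq_def intro: le_trans)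
  have U: "U = (\<Union>k. (pre ^^ k) P)" by (auto simp: U_def)
  have pre_UN: "pre (\<Union>n. A n) = (\<Union>n. pre (A n))" for A :: "nat \<Rightarrow> _"
    by (auto simp: pre_def)
  have "pre U = (\<Union>k. (pre ^^ Suc k) P)"
    unfolding U pre_UN by simp
  then have pre_U: "pre U \<subseteq> U"
    unfolding U by blast
  have mono_pre: "pre A \<subseteq> pre B" if "A \<subseteq> B" for A B using that by (auto simp: pre_def)
  have dec: "decseq (\<lambda>n. (pre ^^ n) U)"
  proof (rule decseq_SucI)
    show "(pre ^^ Suc n) U \<subseteq> (pre ^^ n) U" for n
      using pre_U by (induction n) (simp_all add: mono_pre)
  qed
  define V where "V = (\<Inter>n. (pre ^^ n) U)"
  have "maxi V"
    unfolding V_def by (intro maxi_INT maxi_iter \<open>maxi U\<close> dec)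
  then have V: "V \<in> sets M" by (simp add: maxi_def)
  have "pre V = (\<Inter>n. (pre ^^ Suc n) U)"
    by (auto simp: V_def pre_def)
  also have "\<dots> = V"
    unfolding V_def
  proof (intro equalityI INT_greatest)
    show "(\<Inter>n. (pre ^^ Suc n) U) \<subseteq> (pre ^^ n) U" for n
      using decseq_SucD[OF dec, of n] by (rule INF_lower2[OF UNIV_I])
    show "(\<Inter>n. (pre ^^ n) U) \<subseteq> (pre ^^ Suc n) U" for n
      by (rule INF_lower[OF UNIV_I])
  qed
  finally have inv: "T -` V \<inter> space M = V" by (simp add: pre_def)
  then have M01: "M.prob V = 0 \<or> M.prob V = 1" and N01: "N.prob V = 0 \<or> N.prob V = 1"
    using M N V sets_eq space_eq by (auto simp: ergodic_measure_def)
  \<comment> \<open>\<open>d\<close> changes sign under complementation, so it is positive somewhere unless it vanishes identically.\<close>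
  have "\<exists>B\<in>sets M. d B > 0"
  proof (rule ccontr)
    assume "\<not> ?thesis"
    then have neg: "d B \<le> 0" if "B \<in> sets M" for B using that by (auto simp: not_less)
    have "d B = 0" if B: "B \<in> sets M" for B
    proof -
      have "d (space M - B) = - d B"
        using B sets_eq by (simp add: d_def M.prob_compl) (simp add: space_eq N.prob_compl)
      then show ?thesis using neg[OF B] neg[of "space M - B"] B by auto
    qed
    then have "M = N"
      by (intro measure_eqI) (auto simp: sets_eq d_def M.emeasure_eq_measure N.emeasure_eq_measure)
    with \<open>M \<noteq> N\<close> show False by simp
  qed
  then have "d V > 0" using \<open>maxi V\<close> by (force simp: maxi_def)
  then have "M.prob V = 1" "N.prob V = 0"
    using M01 N01 measure_nonneg[of N V] by (auto simp: d_def)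
  then have "emeasure M (space M - V) = 0" "emeasure N V = 0"
    using V by (auto simp: M.emeasure_eq_measure N.emeasure_eq_measure M.prob_compl)
  then show ?thesis
    using V sets_eq space_eq unfolding mutually_singular_def
    by (intro conjI bexI[of _ "space M - V"]) (auto simp: Diff_Diff_Int Int_absorb2 dest: sets.sets_into_space)
qed

section \<open>Reading a scenery along a path\<close>

definition reading :: "(nat \<Rightarrow> int) \<Rightarrow> nat \<Rightarrow> scenery \<Rightarrow> bool list" where
  "reading s n z = map (\<lambda>i. z (s i)) [0..<n]"

lemma measurable_reading [measurable]:
  "reading s n \<in> measurable borel (count_space UNIV)"
proof (induction n)
  case (Suc n)
  have [measurable]: "(\<lambda>z :: scenery. z k) \<in> measurable borel (count_space UNIV)" for k
    using measurable_eval[where 'a = bool, of k] unfolding measurable_borel_eq_count_space .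
  note Suc [measurable]
  have "reading s (Suc n) = (\<lambda>z. reading s n z @ [z (s n)])"
    by (simp add: reading_def fun_eq_iff)
  then show ?case by simp
qed (simp add: reading_def)

lemma reading_eq_iff: "reading s n z = w \<longleftrightarrow> length w = n \<and> (\<forall>i<n. z (s i) = w ! i)"
  by (auto simp: reading_def list_eq_iff_nth_eq)

lemma reading_cong: "(\<And>i. i < n \<Longrightarrow> s i = t i) \<Longrightarrow> reading s n z = reading t n z"
  by (simp add: reading_def)

lemma rev_reading: "rev (reading s n z) = reading (\<lambda>i. s (n - Suc i)) n z"
  by (simp add: reading_def rev_nth list_eq_iff_nth_eq)

text \<open>
  A path that stays in a window of \<open>m\<close> sites sees only the colours in this window, so what it reads
  is a function of the straight reading of the window.
\<close>

lemma reading_inside_window: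
  assumes "\<And>i. i < n \<Longrightarrow> s i \<in> {a..<a + int m}"
  shows "reading s n z = map (\<lambda>i. reading int m (shift_pow a z) ! nat (s i - a)) [0..<n]"
  using assms by (force simp: reading_def shift_pow_def nat_less_iff)

lemma reading_recording:
  "reading int n (recording (\<omega>, z)) = reading (\<lambda>i. position \<omega> (int i)) n z"
  by (simp add: reading_def recording_def shift_pow_def)

lemma position_Suc: "position \<omega> (int (Suc i)) = position \<omega> (int i) + \<omega> (int i)"
proof -
  have "{0..<int (Suc i)} = insert (int i) {0..<int i}" by auto
  then show ?thesis by (simp add: position_def)
qed

lemma position_straight:
  assumes "\<And>i. i < n \<Longrightarrow> \<omega> (int i) = c" "i \<le> n"
  shows "position \<omega> (int i) = c * int i"
  using assms(2)
proof (induction i)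
  case (Suc i)
  then show ?case using assms(1)[of i] by (simp only: position_Suc) (simp add: algebra_simps)
qed (simp add: position_def)

text \<open>
  A path with \<open>n\<close> steps visits at most \<open>n + 1\<close> sites, and it must go straight to visit as many. The
  first step that deviates from a straight beginning keeps the path in the window visited so far,
  and each later step enlarges this window by at most one site.
\<close>

lemma straight_or_confined:
  assumes "\<omega> \<in> Omega"
  shows "(\<forall>i<n. \<omega> (int i) = 1) \<or> (\<forall>i<n. \<omega> (int i) = -1) \<or>
    (\<exists>a. \<forall>i\<le>n. position \<omega> (int i) \<in> {a..<a + int n})"
proof (induction n)
  case (Suc n)
  have step: "\<omega> (int n) \<in> {-1, 0, 1}" using assms by (auto simp: Omega_def)
  note pos = position_Suc[of \<omega> n]
  consider (right) "\<forall>i<n. \<omega> (int i) = 1" | (left) "\<forall>i<n. \<omega> (int i) = -1"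
    | (confined) a where "\<forall>i\<le>n. position \<omega> (int i) \<in> {a..<a + int n}"
    using Suc.IH by blast
  then show ?case
  proof cases
    case right
    then have p: "position \<omega> (int i) = int i" if "i \<le> n" for i
      using position_straight[of n \<omega> 1 i] that by simp
    show ?thesis
    proof (cases "\<omega> (int n) = 1")
      case True
      then show ?thesis using right by (auto simp: less_Suc_eq)
    next
      case False
      show ?thesis
      proof (cases "n = 0")
        case True
        have "position \<omega> 0 = 0" by (simp add: position_def)
        then show ?thesis
          using step False True pos
          by (auto simp: le_Suc_eq intro: exI[of _ 0])
      next
        case n: False
        have "position \<omega> (int i) \<in> {0..<0 + int (Suc n)}" if "i \<le> Suc n" for i
          using that step False n p pos by (cases "i = Suc n") auto
        then show ?thesis by blast
      qed
    qed
  next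
    case left
    then have p: "position \<omega> (int i) = - int i" if "i \<le> n" for i
      using position_straight[of n \<omega> "-1" i] that by simp
    show ?thesis
    proof (cases "\<omega> (int n) = -1")
      case True
      then show ?thesis using left by (auto simp: less_Suc_eq)
    next
      case False
      show ?thesis
      proof (cases "n = 0")
        case True
        have "position \<omega> 0 = 0" by (simp add: position_def)
        then show ?thesis
          using step False True pos
          by (auto simp: le_Suc_eq intro: exI[of _ 0])
      next
        case n: False
        have "position \<omega> (int i) \<in> {- int n..<- int n + int (Suc n)}" if "i \<le> Suc n" for i
          using that step False n p pos by (cases "i = Suc n") auto
        then show ?thesis by blast
      qed
    qed
  next
    case confined
    \<comment> \<open>The window grows by one site, to the left only if the last step leaves it there.\<close>
    define b where "b = (if position \<omega> (int (Suc n)) < a then a - 1 else a)"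
    have "position \<omega> (int i) \<in> {b..<b + int (Suc n)}" if "i \<le> Suc n" for i
    proof (cases "i = Suc n")
      case True
      then show ?thesis using confined[rule_format, of n] step pos by (auto simp: b_def)
    next
      case False
      then show ?thesis using confined[rule_format, of i] that by (auto simp: b_def)
    qed
    then show ?thesis by blast
  qed
qed simp

section \<open>Recovering a stationary scenery law from its global record measure\<close>

locale stationary_scenery = prob_space M for M :: "scenery measure" +
  assumes sets_eq [measurable_cong]: "sets M = sets borel"
    and invariant: "distr M M left_shift = M"
begin

lemma space_eq [simp]: "space M = UNIV"
  using sets_eq_imp_space_eq[OF sets_eq] by simp

definition window_law :: "nat \<Rightarrow> bool list measure" where
  "window_law n = distr M (count_space UNIV) (reading int n)"

lemma emeasure_window_law: "emeasure (window_law n) V = emeasure M {z. reading int n z \<in> V}"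
proof -
  have "reading int n \<in> measurable M (count_space UNIV)"
    unfolding measurable_cong_sets[OF sets_eq refl] by (rule measurable_reading)
  from emeasure_distr[OF this, of V] show ?thesis
    by (simp add: window_law_def vimage_def)
qed

lemma measurable_shift_pow: "shift_pow k \<in> measurable (borel :: scenery measure) borel"
proof (rule measurable_into_scenery)
  fix n
  have "(\<lambda>z :: scenery. z (n + k)) \<in> measurable borel (count_space UNIV)"
    using measurable_eval[where 'a = bool, of "n + k"] unfolding measurable_borel_eq_count_space .
  then show "(\<lambda>z :: scenery. shift_pow k z n) \<in> measurable borel (count_space UNIV)"
    by (simp add: shift_pow_def)
qed

text \<open>
  The assumption on \<open>left_shift\<close> covers shifts to the left; a shift to the right is undone by one
  to the left.
\<close>

lemma prob_shift:
  assumes Q: "Measurable.pred borel Q"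
  shows "prob {z. Q (shift_pow k z)} = prob {z. Q z}"
proof -
  have shift1: "left_shift = (shift_pow 1 :: scenery \<Rightarrow> _)"
    by (simp add: left_shift_def shift_pow_def fun_eq_iff)
  have nat: "prob {z. R (shift_pow (int n) z)} = prob {z. R z}"
    if R: "Measurable.pred borel R" for R n
  proof (induction n)
    case 0
    show ?case by (simp add: shift_pow_def)
  next
    case (Suc n)
    have "prob {z. R (shift_pow (int n) z)} = measure (distr M M (shift_pow 1)) {z. R (shift_pow (int n) z)}"
      unfolding invariant[unfolded shift1] ..
    also have "\<dots> = prob (shift_pow 1 -` {z. R (shift_pow (int n) z)} \<inter> space M)"
    proof (rule measure_distr)
      show "shift_pow 1 \<in> measurable M M"
        unfolding measurable_cong_sets[OF sets_eq sets_eq] by (rule measurable_shift_pow)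
      have "{z. R (shift_pow (int n) z)} \<in> sets borel"
        using measurable_compose[OF measurable_shift_pow R]
        by (simp only: pred_def space_borel UNIV_I simp_thms)
      then show "{z. R (shift_pow (int n) z)} \<in> sets M" unfolding sets_eq .
    qed
    also have "\<dots> = prob {z. R (shift_pow (int (Suc n)) z)}"
      by (simp add: shift_pow_def vimage_def algebra_simps)
    finally show ?case unfolding Suc ..
  qed
  show ?thesis
  proof (cases "k \<ge> 0")
    case True
    then show ?thesis using nat[OF Q, of "nat k"] by simp
  next
    case False
    have "prob {z. Q (shift_pow k (shift_pow (int (nat (- k))) z))} = prob {z. Q (shift_pow k z)}"
      by (rule nat) (rule measurable_compose[OF measurable_shift_pow Q])
    then show ?thesis using False by (simp add: shift_pow_def)
  qed
qed

text \<open>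
  By stationarity the place of the confining window is irrelevant, so that the probability of a
  reading along a confined path depends on \<open>M\<close> through the distribution of one window only.
\<close>

lemma prob_reading_confined:
  assumes "\<And>i. i < n \<Longrightarrow> s i \<in> {a..<a + int m}"
  shows "prob {z. reading s n z = w} =
    measure (window_law m) {v. map (\<lambda>i. v ! nat (s i - a)) [0..<n] = w}"
proof -
  let ?F = "\<lambda>v. map (\<lambda>i. v ! nat (s i - a)) [0..<n]"
  have "prob {z. reading s n z = w} = prob {z. ?F (reading int m (shift_pow a z)) = w}"
    by (simp add: reading_inside_window[where z = _, OF assms])
  also have "\<dots> = prob {z. ?F (reading int m z) = w}"
  proof (rule prob_shift)
    show "Measurable.pred borel (\<lambda>z. ?F (reading int m z) = w)"
      by (rule measurable_compose[OF measurable_reading]) simp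
  qed
  also have "\<dots> = measure (window_law m) {v. ?F v = w}"
    by (simp add: measure_def emeasure_window_law)
  finally show ?thesis .
qed

lemma prob_reading_backwards:
  "prob {z. reading (\<lambda>i. - int i) n z = w} = prob {z. reading int n z = rev w}"
proof -
  have "reading int n z = rev w \<longleftrightarrow> rev (reading int n z) = w" for z
    by auto
  then have "prob {z. reading int n z = rev w} = prob {z. reading (\<lambda>i. int (n - Suc i)) n z = w}"
    by (simp add: rev_reading)
  also have "\<dots> = prob {z. reading (\<lambda>i. - int i) n (shift_pow (int n - 1) z) = w}"
    by (simp add: reading_eq_iff shift_pow_def of_nat_diff algebra_simps)
  also have "\<dots> = prob {z. reading (\<lambda>i. - int i) n z = w}"
  proof (rule prob_shift)
    show "Measurable.pred borel (\<lambda>z. reading (\<lambda>i. - int i) n z = w)"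
      by (rule measurable_compose[OF measurable_reading]) simp
  qed
  finally show ?thesis by simp
qed

text \<open>
  By Fubini's theorem, with the walk fixed first, a record probability is the average over the
  walks of the probability that the scenery shows the word along the path of the walk.
\<close>

lemma measure_global_record:
  assumes "prob_space \<mu>" and sets_\<mu> [measurable_cong]: "sets \<mu> = sets step_space"
  defines "g \<equiv> \<lambda>w \<omega>. prob {z. reading (\<lambda>i. position \<omega> (int i)) (length w) z = w}"
  shows "measure (global_record_measure \<mu> M) {z. reading int (length w) z = w} = (\<integral>\<omega>. g w \<omega> \<partial>\<mu>)"
    and "integrable \<mu> (g w)"
proof -
  interpret \<mu>: prob_space \<mu> by fact
  have [measurable_cong]: "sets (\<mu> \<Otimes>\<^sub>M M) = sets (step_space \<Otimes>\<^sub>M borel)"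
    by (intro sets_pair_measure_cong sets_\<mu> sets_eq)
  have rec: "recording \<in> measurable (\<mu> \<Otimes>\<^sub>M M) borel"
    using measurable_recording by measurable
  define E where "E = recording -` {z. reading int (length w) z = w} \<inter> space (\<mu> \<Otimes>\<^sub>M M)"
  have E: "E \<in> sets (\<mu> \<Otimes>\<^sub>M M)"
    unfolding E_def by (rule measurable_sets[OF rec]) measurable
  have section_E: "Pair \<omega> -` E = {z. reading (\<lambda>i. position \<omega> (int i)) (length w) z = w}"
    if "\<omega> \<in> space \<mu>" for \<omega>
    using that by (auto simp: E_def space_pair_measure reading_recording)
  have meas: "(\<lambda>\<omega>. emeasure M (Pair \<omega> -` E)) \<in> borel_measurable \<mu>"
    by (rule measurable_emeasure_Pair[OF E])
  have g_eq: "g w \<omega> = enn2real (emeasure M (Pair \<omega> -` E))" if "\<omega> \<in> space \<mu>" for \<omega>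
    using that by (simp add: section_E g_def measure_def)
  have g_meas: "g w \<in> borel_measurable \<mu>"
    by (rule iffD2[OF measurable_cong borel_measurable_enn2real[OF meas]]) (rule g_eq)
  show "integrable \<mu> (g w)"
  proof (rule \<mu>.integrable_const_bound[OF _ g_meas])
    show "AE \<omega> in \<mu>. norm (g w \<omega>) \<le> 1" by (simp add: g_def)
  qed
  have "measure (global_record_measure \<mu> M) {z. reading int (length w) z = w}
      = measure (\<mu> \<Otimes>\<^sub>M M) E"
    unfolding global_record_measure_def E_def by (rule measure_distr[OF rec]) measurable
  also have "\<dots> = enn2real (\<integral>\<^sup>+\<omega>. emeasure M (Pair \<omega> -` E) \<partial>\<mu>)"
    by (simp add: measure_def emeasure_pair_measure_alt[OF E])
  also have "\<dots> = enn2real (\<integral>\<^sup>+\<omega>. ennreal (g w \<omega>) \<partial>\<mu>)"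
    by (intro arg_cong[of _ _ enn2real] nn_integral_cong) (simp add: g_def section_E emeasure_eq_measure)
  also have "\<dots> = (\<integral>\<omega>. g w \<omega> \<partial>\<mu>)"
  proof (rule integral_eq_nn_integral[OF g_meas, symmetric])
    show "AE \<omega> in \<mu>. 0 \<le> g w \<omega>" by (simp add: g_def)
  qed
  finally show "measure (global_record_measure \<mu> M) {z. reading int (length w) z = w} = (\<integral>\<omega>. g w \<omega> \<partial>\<mu>)" .
qed

end

text \<open>
  The first records of \<open>n + 1\<close> colours bring in the windows of \<open>n + 1\<close> sites only through the two
  straight paths; all other paths are settled by the windows of \<open>n\<close> sites. Each word is thereby
  coupled with its reversal alone, and strong asymmetry separates the two.
\<close>

theorem window_law_determined_by_record:
  assumes "stationary_scenery \<nu>" "stationary_scenery \<nu>'"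
    and "prob_space \<mu>" and sets_\<mu>: "sets \<mu> = sets step_space"
    and asym: "strongly_asymmetric \<mu>"
    and rho: "global_record_measure \<mu> \<nu> = global_record_measure \<mu> \<nu>'"
  shows "stationary_scenery.window_law \<nu> n = stationary_scenery.window_law \<nu>' n"
proof -
  interpret X: stationary_scenery \<nu> by fact
  interpret Y: stationary_scenery \<nu>' by fact
  interpret \<mu>: prob_space \<mu> by fact
  have space_\<mu>: "space \<mu> = Omega"
    using sets_eq_imp_space_eq[OF sets_\<mu>] by (simp add: space_step_space)
  define D where "D w = X.prob {z. reading int (length w) z = w} - Y.prob {z. reading int (length w) z = w}" for w
  have law_eqI: "X.window_law n = Y.window_law n" if "\<And>w. length w = n \<Longrightarrow> D w = 0" for n
  proof (rule measure_eqI_countable[of _ UNIV])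
    fix w :: "bool list"
    have "X.prob {z. reading int n z = w} = Y.prob {z. reading int n z = w}"
    proof (cases "length w = n")
      case True
      then show ?thesis using that[of w] by (simp add: D_def)
    qed (simp add: reading_eq_iff)
    then show "emeasure (X.window_law n) {w} = emeasure (Y.window_law n) {w}"
      by (simp add: X.emeasure_window_law Y.emeasure_window_law X.emeasure_eq_measure Y.emeasure_eq_measure)
  qed (auto simp: X.window_law_def Y.window_law_def)
  define g where "g w \<omega> = X.prob {z. reading (\<lambda>i. position \<omega> (int i)) (length w) z = w}
      - Y.prob {z. reading (\<lambda>i. position \<omega> (int i)) (length w) z = w}" for w \<omega>
  have int_g: "(\<integral>\<omega>. g w \<omega> \<partial>\<mu>) = 0" for w
    unfolding g_def
    using X.measure_global_record[OF \<open>prob_space \<mu>\<close> sets_\<mu>, of w]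
      Y.measure_global_record[OF \<open>prob_space \<mu>\<close> sets_\<mu>, of w] rho
    by (simp add: Bochner_Integration.integral_diff)
  define C where "C c n = {\<omega>\<in>Omega. \<forall>i<n. \<omega> (int i) = c}" for c n
  have C_sets: "C c n \<in> sets \<mu>" for c n
  proof -
    have "(\<lambda>\<omega>::int\<Rightarrow>int. \<omega> i) \<in> measurable borel (count_space UNIV)" for i
      using measurable_eval[where 'a = int, of i] unfolding measurable_borel_eq_count_space .
    then have [measurable]: "(\<lambda>\<omega>. \<omega> i) \<in> measurable step_space (count_space UNIV)" for i
      unfolding step_space_def by (rule measurable_restrict_space1)
    have "{\<omega>\<in>space step_space. \<forall>i<n. \<omega> (int i) = c} \<in> sets step_space"
      by measurable
    then show ?thesis unfolding C_def sets_\<mu> space_step_space .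
  qed
  have C_word: "\<mu>.prob (C c n) = word_measure \<mu> (replicate n c)" for c n
    by (auto simp: C_def word_measure_def intro!: arg_cong[of _ _ \<mu>.prob])
  have g_right: "g w \<omega> = D w" if "\<omega> \<in> C 1 n" "length w = Suc n" for w \<omega> n
  proof -
    have "reading (\<lambda>i. position \<omega> (int i)) (Suc n) z = reading int (Suc n) z" for z
      using that position_straight[of n \<omega> 1] by (intro reading_cong) (auto simp: C_def)
    then show ?thesis using that by (simp add: g_def D_def)
  qed
  have g_left: "g w \<omega> = D (rev w)" if "\<omega> \<in> C (-1) n" "length w = Suc n" for w \<omega> n
  proof -
    have "reading (\<lambda>i. position \<omega> (int i)) (Suc n) z = reading (\<lambda>i. - int i) (Suc n) z" for z
      using that position_straight[of n \<omega> "-1"] by (intro reading_cong) (auto simp: C_def)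
    then show ?thesis
      using that by (simp add: g_def D_def X.prob_reading_backwards Y.prob_reading_backwards)
  qed
  show ?thesis
  proof (induction n)
    case 0
    show ?case
      by (rule law_eqI) (simp add: D_def reading_def X.prob_space[simplified] Y.prob_space[simplified])
  next
    case (Suc n)
    show ?case
    proof (cases "n = 0")
      \<comment> \<open>For windows of one site the two straight paths coincide and have total mass \<open>1\<close>.\<close>
      case True
      have "D w = 0" if "length w = Suc n" for w
      proof -
        have "g w \<omega> = D w" if "\<omega> \<in> space \<mu>" for \<omega>
          using that \<open>length w = Suc n\<close> True by (intro g_right[of _ n]) (auto simp: C_def space_\<mu>)
        then have "(\<integral>\<omega>. g w \<omega> \<partial>\<mu>) = (\<integral>\<omega>. D w \<partial>\<mu>)"
          by (intro Bochner_Integration.integral_cong) auto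
        then show ?thesis using int_g[of w] by (simp add: \<mu>.prob_space)
      qed
      then show ?thesis by (rule law_eqI)
    next
      case False
      let ?r = "\<mu>.prob (C 1 n)" and ?l = "\<mu>.prob (C (-1) n)"
      have linear: "?r * D w + ?l * D (rev w) = 0" if w: "length w = Suc n" for w
      proof -
        have "g w \<omega> = D w * indicator (C 1 n) \<omega> + D (rev w) * indicator (C (-1) n) \<omega>"
          if \<omega>: "\<omega> \<in> space \<mu>" for \<omega>
        proof -
          have disj: "\<not> (\<omega> \<in> C 1 n \<and> \<omega> \<in> C (-1) n)"
            using False by (force simp: C_def)
          consider "\<omega> \<in> C 1 n" | "\<omega> \<in> C (-1) n"
            | a where "\<omega> \<notin> C 1 n" "\<omega> \<notin> C (-1) n" "\<forall>i\<le>n. position \<omega> (int i) \<in> {a..<a + int n}"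
            using straight_or_confined[of \<omega> n] \<omega> by (auto simp: C_def space_\<mu>)
          then show ?thesis
          proof cases
            case 1
            then show ?thesis using disj g_right[OF 1 w] by auto
          next
            case 2
            then show ?thesis using disj g_left[OF 2 w] by auto
          next
            case 3
            have "position \<omega> (int i) \<in> {a..<a + int n}" if "i < Suc n" for i
              using 3 that by auto
            from X.prob_reading_confined[OF this] Y.prob_reading_confined[OF this]
            have "g w \<omega> = 0" unfolding g_def w Suc.IH by simp
            then show ?thesis using 3 by simp
          qed
        qed
        then have "(\<integral>\<omega>. g w \<omega> \<partial>\<mu>)
            = (\<integral>\<omega>. D w * indicator (C 1 n) \<omega> + D (rev w) * indicator (C (-1) n) \<omega> \<partial>\<mu>)"
          by (intro Bochner_Integration.integral_cong) auto
        also have "\<dots> = D w * ?r + D (rev w) * ?l"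
          using C_sets by (subst Bochner_Integration.integral_add) (auto simp: \<mu>.emeasure_eq_measure)
        finally show ?thesis using int_g[of w] by (simp add: mult.commute)
      qed
      have "?r \<noteq> ?l"
        using asym False by (simp add: C_word strongly_asymmetric_def)
      moreover have "?r + ?l > 0"
        using \<open>?r \<noteq> ?l\<close> by (smt (verit) measure_nonneg)
      ultimately have det: "?r * ?r - ?l * ?l \<noteq> 0"
        by (metis add_less_same_cancel1 eq_iff_diff_eq_0 mult_eq_0_iff not_square_less_zero square_diff_square_factored less_irrefl)
      \<comment> \<open>Cramer's rule for the equations of \<open>w\<close> and \<open>rev w\<close>.\<close>
      have "D w = 0" if w: "length w = Suc n" for w
      proof -
        have "?r * (?r * D w + ?l * D (rev w)) - ?l * (?r * D (rev w) + ?l * D w) = 0"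
          using linear[OF w] linear[of "rev w"] w by simp
        then have "(?r * ?r - ?l * ?l) * D w = 0" by (simp add: algebra_simps)
        with det show ?thesis by simp
      qed
      then show ?thesis by (rule law_eqI)
    qed
  qed
qed

section \<open>Periodic sceneries\<close>

lemma Per_periodic:
  assumes "periodic x"
  shows "Per x \<ge> 1" "(left_shift ^^ Per x) x = x"
  using LeastI_ex[of "\<lambda>p. p \<ge> 1 \<and> (left_shift ^^ p) x = x"] assms
  unfolding periodic_def Per_def by auto

lemma periodic_add:
  assumes "periodic x"
  shows "x (n + int (Per x) * k) = x n"
proof -
  have one: "x (n + int (Per x)) = x n" for n
    using Per_periodic(2)[OF assms] shift_pow_of_nat[of "Per x", where 'a = bool]
    by (metis shift_pow_def)
  show ?thesis
  proof (induction k rule: int_induct[where k = 0])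
    case (step1 i)
    then show ?case using one[of "n + int (Per x) * i"] by (simp add: algebra_simps)
  next
    case (step2 i)
    then show ?case using one[of "n + int (Per x) * (i - 1)"] by (simp add: algebra_simps)
  qed simp
qed

lemma scenery_measure_orbit_pos:
  assumes "periodic x" "A \<in> sets borel" "(left_shift ^^ k) x \<in> A" "k < Per x"
  shows "emeasure (scenery_measure x) A > 0"
proof -
  let ?f = "\<lambda>k. emeasure (return borel ((left_shift ^^ k) x)) A"
  have "?f k = 1" using assms by simp
  then have "(\<Sum>k<Per x. ?f k) \<noteq> 0"
    using assms(4) by (auto simp: sum_eq_0_iff simp del: emeasure_return intro!: bexI[of _ k])
  then show ?thesis
    using assms(2)
    by (simp add: emeasure_scenery_measure ennreal_zero_less_mult_iff ennreal_zero_less_divide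
        zero_less_iff_neq_zero del: emeasure_return)
qed

lemma scenery_measure_posD:
  assumes "A \<in> sets borel" "emeasure (scenery_measure x) A > 0"
  obtains k where "(left_shift ^^ k) x \<in> A"
proof -
  have "\<exists>k. (left_shift ^^ k) x \<in> A"
    using assms by (force simp: emeasure_scenery_measure intro: ccontr)
  then show ?thesis using that by blast
qed

lemma measurable_left_shift: "left_shift \<in> measurable (borel :: scenery measure) borel"
proof (rule measurable_into_scenery)
  show "(\<lambda>z :: scenery. left_shift z n) \<in> measurable borel (count_space UNIV)" for n
    using measurable_eval[where 'a = bool, of "n + 1"]
    unfolding measurable_borel_eq_count_space by (simp add: left_shift_def)
qed

text \<open>The shift permutes the points of a periodic orbit cyclically.\<close>

lemma stationary_scenery_measure:
  assumes "periodic x"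
  shows "stationary_scenery (scenery_measure x)"
proof (intro stationary_scenery.intro prob_spaceI stationary_scenery_axioms.intro)
  have space: "space (scenery_measure x) = UNIV"
    using sets_eq_imp_space_eq[OF sets_scenery_measure] by simp
  have "emeasure (scenery_measure x) UNIV = 1 / of_nat (Per x) * of_nat (Per x)"
    by (simp add: emeasure_scenery_measure)
  also have "\<dots> = 1"
    using Per_periodic(1)[OF assms]
    by (subst ennreal_divide_times) (simp add: ennreal_divide_self ennreal_of_nat_eq_real_of_nat)
  finally show "emeasure (scenery_measure x) (space (scenery_measure x)) = 1"
    by (simp add: space)
  show "distr (scenery_measure x) (scenery_measure x) left_shift = scenery_measure x"
  proof (rule measure_eqI)
    fix A assume "A \<in> sets (distr (scenery_measure x) (scenery_measure x) left_shift)"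
    then have A: "A \<in> sets borel" by simp
    let ?f = "\<lambda>k. indicator A ((left_shift ^^ k) x) :: ennreal"
    have pre: "left_shift -` A \<in> sets borel"
      using measurable_sets[OF measurable_left_shift A] by simp
    have "?f 0 + (\<Sum>k<Per x. ?f (Suc k)) = (\<Sum>k<Per x. ?f k) + ?f (Per x)"
      using sum.lessThan_Suc_shift[of ?f "Per x"] sum.lessThan_Suc[of ?f "Per x"] by (rule trans[OF sym])
    moreover have "?f (Per x) = ?f 0"
      using Per_periodic(2)[OF assms] by simp
    moreover have "?f 0 \<noteq> \<infinity>" by (simp add: indicator_def)
    ultimately have "(\<Sum>k<Per x. ?f (Suc k)) = (\<Sum>k<Per x. ?f k)"
      by (metis add.commute ennreal_add_left_cancel infinity_ennreal_def)
    then have sums: "(\<Sum>k<Per x. emeasure (return borel ((left_shift ^^ k) x)) (left_shift -` A))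
        = (\<Sum>k<Per x. emeasure (return borel ((left_shift ^^ k) x)) A)"
      using A pre by (simp add: indicator_def)
    have "left_shift \<in> measurable (scenery_measure x) (scenery_measure x)"
      unfolding measurable_cong_sets[OF sets_scenery_measure sets_scenery_measure]
      by (rule measurable_left_shift)
    from emeasure_distr[OF this, of A]
    have "emeasure (distr (scenery_measure x) (scenery_measure x) left_shift) A
        = emeasure (scenery_measure x) (left_shift -` A)"
      unfolding space Int_UNIV_right sets_scenery_measure using A .
    also have "\<dots> = emeasure (scenery_measure x) A"
      unfolding emeasure_scenery_measure[OF A] emeasure_scenery_measure[OF pre] sums ..
    finally show "emeasure (distr (scenery_measure x) (scenery_measure x) left_shift) A
        = emeasure (scenery_measure x) A" .
  qed simp
qed simp

text \<open>
  A window whose length is a common period determines both sceneries. The word that \<open>y\<close> shows in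
  it has positive probability for \<open>y\<close>, hence for \<open>x\<close>, and so it occurs in a translate of \<open>x\<close>.
\<close>

lemma translate_if_window_laws_eq:
  assumes x: "periodic x" and y: "periodic y"
    and laws: "\<And>n. stationary_scenery.window_law (scenery_measure x) n
      = stationary_scenery.window_law (scenery_measure y) n"
  shows "\<exists>k. y = shift_pow k x"
proof -
  interpret X: stationary_scenery "scenery_measure x" by (rule stationary_scenery_measure[OF x])
  interpret Y: stationary_scenery "scenery_measure y" by (rule stationary_scenery_measure[OF y])
  define n where "n = Per x * Per y"
  define A where "A = {z. reading int n z = reading int n y}"
  have A: "A \<in> sets borel" unfolding A_def by measurable
  have "emeasure (scenery_measure x) A = emeasure (X.window_law n) {reading int n y}"
    by (simp add: X.emeasure_window_law A_def)
  also have "\<dots> = emeasure (scenery_measure y) A"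
    by (simp add: laws Y.emeasure_window_law A_def)
  also have "\<dots> > 0"
    using Per_periodic(1)[OF y] by (intro scenery_measure_orbit_pos[OF y A, of 0]) (auto simp: A_def)
  finally obtain k where "(left_shift ^^ k) x \<in> A"
    using scenery_measure_posD[OF A] by blast
  then have agree: "x (int j + int k) = y (int j)" if "j < n" for j
    using that by (auto simp: A_def reading_eq_iff shift_pow_of_nat[symmetric] shift_pow_def reading_def)
  have "n > 0" using Per_periodic(1)[OF x] Per_periodic(1)[OF y] by (simp add: n_def)
  have "y m = x (m + int k)" for m
  proof -
    define j where "j = nat (m mod int n)"
    have "j < n" using \<open>n > 0\<close> by (simp add: j_def nat_less_iff)
    define q where "q = m div int n"
    have m: "m = int j + int n * q" using \<open>n > 0\<close> by (simp add: j_def q_def)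
    have "y m = y (int j)"
      using periodic_add[OF y, of "int j" "int (Per x) * q"]
      by (simp add: m n_def mult_ac)
    also have "\<dots> = x (int j + int k)" using agree[OF \<open>j < n\<close>] by simp
    also have "\<dots> = x (m + int k)"
      using periodic_add[OF x, of "int j + int k" "int (Per y) * q"]
      by (simp add: m n_def mult_ac add_ac)
    finally show ?thesis .
  qed
  then show ?thesis by (auto simp: shift_pow_def)
qed

text \<open>
  The global record measure is the average of the record measures over the orbit of \<open>x\<close>. A set that
  is null for it is therefore null for the record measure of almost every scenery, and \<open>x\<close> is an
  atom of its scenery measure.
\<close>

lemma null_record_measure:
  assumes x: "periodic x" and "prob_space \<mu>" and sets_\<mu> [measurable_cong]: "sets \<mu> = sets step_space"
    and A: "A \<in> sets borel"
    and null: "emeasure (global_record_measure \<mu> (scenery_measure x)) A = 0"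
  shows "emeasure (record_measure \<mu> x) A = 0"
proof -
  interpret \<mu>: prob_space \<mu> by fact
  interpret X: stationary_scenery "scenery_measure x" by (rule stationary_scenery_measure[OF x])
  interpret pair_sigma_finite \<mu> "scenery_measure x" ..
  have [measurable_cong]: "sets (\<mu> \<Otimes>\<^sub>M scenery_measure x) = sets (step_space \<Otimes>\<^sub>M borel)"
    by (intro sets_pair_measure_cong sets_\<mu>) simp
  have rec: "recording \<in> measurable (\<mu> \<Otimes>\<^sub>M scenery_measure x) borel"
    using measurable_recording by measurable
  define E where "E = recording -` A \<inter> space (\<mu> \<Otimes>\<^sub>M scenery_measure x)"
  have E: "E \<in> sets (\<mu> \<Otimes>\<^sub>M scenery_measure x)"
    unfolding E_def by (rule measurable_sets[OF rec A])
  let ?f = "\<lambda>z. emeasure \<mu> ((\<lambda>\<omega>. (\<omega>, z)) -` E)"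
  let ?B = "?f -` (UNIV - {0}) \<inter> space (scenery_measure x)"
  have f: "?f \<in> borel_measurable (scenery_measure x)"
    by (rule measurable_emeasure_Pair2[OF E])
  have "UNIV - {0 :: ennreal} \<in> sets borel"
    by simp
  from measurable_sets[OF f this] have B: "?B \<in> sets borel"
    unfolding sets_scenery_measure .
  have "(\<integral>\<^sup>+z. ?f z \<partial>scenery_measure x) = 0"
    using null emeasure_distr[OF rec A] emeasure_pair_measure_alt2[OF E]
    by (simp add: global_record_measure_def E_def)
  then have "emeasure (scenery_measure x) {z \<in> space (scenery_measure x). ?f z \<noteq> 0} = 0"
    unfolding nn_integral_0_iff[OF f] .
  moreover have "{z \<in> space (scenery_measure x). ?f z \<noteq> 0} = ?B"
    by blast
  ultimately have "x \<notin> ?B"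
    using scenery_measure_orbit_pos[OF x B, of 0] Per_periodic(1)[OF x] by fastforce
  then have "?f x = 0"
    by (simp only: vimage_eq Int_iff X.space_eq UNIV_I Diff_iff singleton_iff simp_thms)
  moreover have "(\<lambda>\<omega>. (\<omega>, x)) -` E = colour_record x -` A \<inter> space \<mu>"
    by (auto simp: E_def space_pair_measure colour_record_def)
  moreover have "colour_record x \<in> measurable \<mu> borel"
    unfolding measurable_cong_sets[OF sets_\<mu> refl] by (rule measurable_colour_record)
  then have "emeasure (record_measure \<mu> x) A = emeasure \<mu> (colour_record x -` A \<inter> space \<mu>)"
    unfolding record_measure_def using A by (rule emeasure_distr)
  ultimately show ?thesis by metis
qed

theorem theorem3:
  fixes \<mu> :: "(int \<Rightarrow> int) measure" and x y :: scenery
  assumes "sets \<mu> = sets step_space"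
    and "ergodic_measure left_shift \<mu>"
    and "strongly_asymmetric \<mu>"
    and "periodic x" and "periodic y"
    and "\<not> (\<exists>k. y = shift_pow k x)"
    and "ergodic_measure left_shift (global_record_measure \<mu> (scenery_measure x))"
    and "ergodic_measure left_shift (global_record_measure \<mu> (scenery_measure y))"
  shows "mutually_singular (record_measure \<mu> x) (record_measure \<mu> y)"
proof -
  let ?\<rho> = "\<lambda>z. global_record_measure \<mu> (scenery_measure z)"
  have \<mu>: "prob_space \<mu>"
    using assms(2) by (simp add: ergodic_measure_def)
  have "?\<rho> x \<noteq> ?\<rho> y"
  proof
    assume "?\<rho> x = ?\<rho> y"
    then have "\<exists>k. y = shift_pow k x"
      using assms(1,3-5) \<mu>
      by (intro translate_if_window_laws_eq window_law_determined_by_record stationary_scenery_measure)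
    with assms(6) show False by contradiction
  qed
  then have "mutually_singular (?\<rho> x) (?\<rho> y)"
    using assms(7,8) by (intro distinct_ergodic_measures_singular) (auto simp: global_record_measure_def)
  then obtain A where A: "A \<in> sets borel" "emeasure (?\<rho> x) A = 0" "emeasure (?\<rho> y) (UNIV - A) = 0"
    by (auto simp: mutually_singular_def global_record_measure_def)
  have "emeasure (record_measure \<mu> x) A = 0" "emeasure (record_measure \<mu> y) (UNIV - A) = 0"
    using A assms(1,4,5) \<mu> by (auto intro: null_record_measure)
  then show ?thesis
    using A(1) by (auto simp: mutually_singular_def record_measure_def)
qed

end
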